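(* Let $f\colon P\to Q$ be a surjective quandle homomorphism and put $H_f=\mathrm{Inn}_{\mathrm{rel}}(f)/\mathrm{Trans}_{\mathrm{rel}}(f)$. Then there is a short exact sequence $$1\longrightarrow H_f\longrightarrow \mathrm{Inn}(P)/\mathrm{Trans}_{\mathrm{rel}}(f)\longrightarrow \mathrm{Inn}(Q)\longrightarrow 1,$$ which is a central group extension.
   Context: A quandle is a set $Q$ with bijections $s_x\colon Q\to Q$ ($x\in Q$) such that $s_x(x)=x$ and $s_x\circ s_y=s_{s_x(y)}\circ s_x$ for all $x,y\in Q$. A quandle homomorphism $f\colon P\to Q$ is a map with $f(s_x(y))=s_{f(x)}(f(y))$ for all $x,y\in P$. The inner automorphism group $\mathrm{Inn}(P)$ is the group of permutations of $P$ generated by all $s_x$, $x\in P$. A surjective quandle homomorphism $f\colon P\to Q$ induces a surjective group homomorphism $f_*\colon\mathrm{Inn}(P)\to\mathrm{Inn}(Q)$, where $f_*(\varphi)$ is the unique element of $\mathrm{Inn}(Q)$ with $f\circ\varphi=f_*(\varphi)\circ f$. Put $\mathrm{Inn}_{\mathrm{rel}}(f)=\ker(f_* )$ and $\mathrm{Trans}_{\mathrm{rel}}(f)=\langle s_xs_y^{-1}\mid x,y\in P,\ f(x)=f(y)\rangle$; the latter is a normal subgroup of $\mathrm{Inn}(P)$ contained in $\mathrm{Inn}_{\mathrm{rel}}(f)$. The maps in the sequence are induced by the inclusion $\mathrm{Inn}_{\mathrm{rel}}(f)\subseteq\mathrm{Inn}(P)$ and by $f_*$. *)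

theory Defs
  imports "HOL-Algebra.Coset" "HOL-Algebra.Bij" "HOL-Algebra.Generated_Groups"
begin

section \<open>Quandles and their inner automorphism groups\<close>

locale quandle =
  fixes Q :: "'a set" and s :: "'a \<Rightarrow> 'a \<Rightarrow> 'a"
  assumes bij: "x \<in> Q \<Longrightarrow> bij_betw (s x) Q Q"
    and self_fixed: "x \<in> Q \<Longrightarrow> s x x = x"
    and dist: "\<lbrakk>x \<in> Q; y \<in> Q; z \<in> Q\<rbrakk> \<Longrightarrow> s x (s y z) = s (s x y) (s x z)"

definition quandle_hom ::
    "'a set \<Rightarrow> ('a \<Rightarrow> 'a \<Rightarrow> 'a) \<Rightarrow> 'b set \<Rightarrow> ('b \<Rightarrow> 'b \<Rightarrow> 'b) \<Rightarrow> ('a \<Rightarrow> 'b) \<Rightarrow> bool"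
  where "quandle_hom P s Q t f \<longleftrightarrow>
    f \<in> P \<rightarrow> Q \<and> (\<forall>x\<in>P. \<forall>y\<in>P. f (s x y) = t (f x) (f y))"

text \<open>Permutations of \<open>Q\<close> are represented by extensional functions, as in \<^const>\<open>BijGroup\<close>;
  hence the restriction of \<open>s x\<close> to \<open>Q\<close>.\<close>

definition sym_perm :: "'a set \<Rightarrow> ('a \<Rightarrow> 'a \<Rightarrow> 'a) \<Rightarrow> 'a \<Rightarrow> 'a \<Rightarrow> 'a"
  where "sym_perm Q s x = restrict (s x) Q"

definition Inn :: "'a set \<Rightarrow> ('a \<Rightarrow> 'a \<Rightarrow> 'a) \<Rightarrow> ('a \<Rightarrow> 'a) monoid"
  where "Inn Q s = subgroup_generated (BijGroup Q) (sym_perm Q s ` Q)"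

text \<open>The map \<open>f\<^sub>*\<close>; it is well defined when \<open>f\<close> is a surjective quandle homomorphism,
  see \<open>Inn_map_ex1\<close> below.\<close>

definition Inn_map ::
    "'a set \<Rightarrow> 'b set \<Rightarrow> ('b \<Rightarrow> 'b \<Rightarrow> 'b) \<Rightarrow> ('a \<Rightarrow> 'b) \<Rightarrow> ('a \<Rightarrow> 'a) \<Rightarrow> ('b \<Rightarrow> 'b)"
  where "Inn_map P Q t f \<phi> =
    (THE \<psi>. \<psi> \<in> carrier (Inn Q t) \<and> (\<forall>x\<in>P. f (\<phi> x) = \<psi> (f x)))"

definition Inn_rel ::
    "'a set \<Rightarrow> ('a \<Rightarrow> 'a \<Rightarrow> 'a) \<Rightarrow> 'b set \<Rightarrow> ('b \<Rightarrow> 'b \<Rightarrow> 'b) \<Rightarrow> ('a \<Rightarrow> 'b) \<Rightarrow> ('a \<Rightarrow> 'a) set"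
  where "Inn_rel P s Q t f = kernel (Inn P s) (Inn Q t) (Inn_map P Q t f)"

definition Trans_rel ::
    "'a set \<Rightarrow> ('a \<Rightarrow> 'a \<Rightarrow> 'a) \<Rightarrow> ('a \<Rightarrow> 'b) \<Rightarrow> ('a \<Rightarrow> 'a) set"
  where "Trans_rel P s f = generate (Inn P s)
    {sym_perm P s x \<otimes>\<^bsub>Inn P s\<^esub> inv\<^bsub>Inn P s\<^esub> (sym_perm P s y) | x y. x \<in> P \<and> y \<in> P \<and> f x = f y}"

definition H_quot ::
    "'a set \<Rightarrow> ('a \<Rightarrow> 'a \<Rightarrow> 'a) \<Rightarrow> 'b set \<Rightarrow> ('b \<Rightarrow> 'b \<Rightarrow> 'b) \<Rightarrow> ('a \<Rightarrow> 'b) \<Rightarrow> ('a \<Rightarrow> 'a) set monoid"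
  where "H_quot P s Q t f = (Inn P s)\<lparr>carrier := Inn_rel P s Q t f\<rparr> Mod Trans_rel P s f"

section \<open>Central extensions\<close>

text \<open>The library's \<open>short_exact_sequence\<close> requires all groups to have the same element type,
  so it does not apply to the sequence considered here.\<close>

definition short_exact ::
    "('a, 'm) monoid_scheme \<Rightarrow> ('a \<Rightarrow> 'b) \<Rightarrow> ('b, 'n) monoid_scheme \<Rightarrow> ('b \<Rightarrow> 'c) \<Rightarrow>
     ('c, 'k) monoid_scheme \<Rightarrow> bool"
  where "short_exact A i B p C \<longleftrightarrow>
    group A \<and> group B \<and> group C \<and> i \<in> mon A B \<and> p \<in> epi B C \<and> i ` carrier A = kernel B C p"

definition group_center :: "('a, 'm) monoid_scheme \<Rightarrow> 'a set"
  where "group_center G = {z \<in> carrier G. \<forall>g\<in>carrier G. z \<otimes>\<^bsub>G\<^esub> g = g \<otimes>\<^bsub>G\<^esub> z}"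

definition central_extension ::
    "('a, 'm) monoid_scheme \<Rightarrow> ('a \<Rightarrow> 'b) \<Rightarrow> ('b, 'n) monoid_scheme \<Rightarrow> ('b \<Rightarrow> 'c) \<Rightarrow>
     ('c, 'k) monoid_scheme \<Rightarrow> bool"
  where "central_extension A i B p C \<longleftrightarrow>
    short_exact A i B p C \<and> i ` carrier A \<subseteq> group_center B"

text \<open>A map \<open>h\<close> that is constant on the cosets of a subgroup, regarded as a map on cosets:
  \<open>X\<close> is sent to the common value of \<open>h\<close> on \<open>X\<close>.\<close>

definition on_cosets :: "('a \<Rightarrow> 'b) \<Rightarrow> 'a set \<Rightarrow> 'b"
  where "on_cosets h X = the_elem (h ` X)"

section \<open>Well-definedness\<close>

lemma group_Inn: "group (Inn Q s)"
  by (simp add: Inn_def group.group_subgroup_generated group_BijGroup)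

lemma carrier_BijGroup: "carrier (BijGroup S) = Bij S"
  by (simp add: BijGroup_def)

lemma (in quandle) sym_perm_Bij: "x \<in> Q \<Longrightarrow> sym_perm Q s x \<in> Bij Q"
  using bij by (auto simp: sym_perm_def Bij_def cong: bij_betw_cong)

lemma (in quandle) carrier_Inn: "carrier (Inn Q s) = generate (BijGroup Q) (sym_perm Q s ` Q)"
proof -
  have "carrier (BijGroup Q) \<inter> sym_perm Q s ` Q = sym_perm Q s ` Q"
    using sym_perm_Bij by (auto simp: BijGroup_def)
  then show ?thesis by (simp add: Inn_def carrier_subgroup_generated)
qed

lemma (in quandle) Inn_subset_Bij: "carrier (Inn Q s) \<subseteq> Bij Q"
  using group.carrier_subgroup_generated_subset[OF group_BijGroup[of Q]]
  by (simp add: Inn_def carrier_BijGroup)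

lemma Inn_map_ex1:
  assumes "quandle P s" "quandle Q t" "quandle_hom P s Q t f" "f ` P = Q"
    and "\<phi> \<in> carrier (Inn P s)"
  shows "\<exists>!\<psi>. \<psi> \<in> carrier (Inn Q t) \<and> (\<forall>x\<in>P. f (\<phi> x) = \<psi> (f x))"
proof (rule ex_ex1I)
  interpret P: quandle P s by fact
  interpret Q: quandle Q t by fact
  interpret BP: group "BijGroup P" by (rule group_BijGroup)
  interpret BQ: group "BijGroup Q" by (rule group_BijGroup)
  have gP: "sym_perm P s ` P \<subseteq> carrier (BijGroup P)"
    using P.sym_perm_Bij by (auto simp: carrier_BijGroup)
  have gQ: "sym_perm Q t ` Q \<subseteq> carrier (BijGroup Q)"
    using Q.sym_perm_Bij by (auto simp: BijGroup_def)
  have fP: "f x \<in> Q" if "x \<in> P" for x using assms(4) that by blast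
  have hom: "f (sym_perm P s x y) = sym_perm Q t (f x) (f y)" if "x \<in> P" "y \<in> P" for x y
    using that assms(3) fP by (simp add: sym_perm_def quandle_hom_def)
  from assms(5) have "\<phi> \<in> generate (BijGroup P) (sym_perm P s ` P)"
    by (simp add: P.carrier_Inn)
  then have "\<exists>\<psi>. \<psi> \<in> generate (BijGroup Q) (sym_perm Q t ` Q) \<and> (\<forall>x\<in>P. f (\<phi> x) = \<psi> (f x))"
  proof induction
    case one
    have "\<forall>x\<in>P. f (\<one>\<^bsub>BijGroup P\<^esub> x) = \<one>\<^bsub>BijGroup Q\<^esub> (f x)"
      by (simp add: BijGroup_def fP)
    then show ?case using generate.one by blast
  next
    case (incl h)
    show ?case
    proof -
      obtain x where x: "x \<in> P" "h = sym_perm P s x" using incl by blast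
      then have "sym_perm Q t (f x) \<in> generate (BijGroup Q) (sym_perm Q t ` Q)"
        using fP by (auto intro: generate.incl)
      with x hom show ?thesis by blast
    qed
  next
    case (inv h)
    then obtain x where x: "x \<in> P" "h = sym_perm P s x" by blast
    let ?k = "sym_perm Q t (f x)"
    have h: "h \<in> Bij P" and k: "?k \<in> Bij Q"
      using x fP P.sym_perm_Bij Q.sym_perm_Bij by auto
    have "f ((inv\<^bsub>BijGroup P\<^esub> h) y) = (inv\<^bsub>BijGroup Q\<^esub> ?k) (f y)" if y: "y \<in> P" for y
    proof -
      define z where "z = inv_into P h y"
      have z: "z \<in> P" "h z = y"
        unfolding z_def using h y bij_betw_inv_into_right[of h P P y]
        by (simp_all add: Bij_inv_into_mem Bij_def)
      have "f y = ?k (f z)" using hom[OF x(1) z(1)] x(2) z(2) by simp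
      then have "inv_into Q ?k (f y) = f z"
        using bij_betw_inv_into_left[of ?k Q Q "f z"] k fP[OF z(1)] by (simp add: Bij_def)
      then show ?thesis using h k y fP by (simp add: inv_BijGroup z_def)
    qed
    moreover have "inv\<^bsub>BijGroup Q\<^esub> ?k \<in> generate (BijGroup Q) (sym_perm Q t ` Q)"
      using x fP by (auto intro: generate.inv)
    ultimately show ?case by blast
  next
    case (eng h1 h2)
    then obtain k1 k2 where
      k: "k1 \<in> generate (BijGroup Q) (sym_perm Q t ` Q)" "\<forall>x\<in>P. f (h1 x) = k1 (f x)"
         "k2 \<in> generate (BijGroup Q) (sym_perm Q t ` Q)" "\<forall>x\<in>P. f (h2 x) = k2 (f x)"
      by blast
    have h: "h1 \<in> Bij P" "h2 \<in> Bij P"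
      using eng.hyps BP.generate_in_carrier[OF gP] carrier_BijGroup by blast+
    have kB: "k1 \<in> Bij Q" "k2 \<in> Bij Q"
      using k(1,3) BQ.generate_in_carrier[OF gQ] carrier_BijGroup by blast+
    have "h2 x \<in> P" if "x \<in> P" for x
      using h that Bij_imp_funcset by blast
    then have "\<forall>x\<in>P. f ((h1 \<otimes>\<^bsub>BijGroup P\<^esub> h2) x) = (k1 \<otimes>\<^bsub>BijGroup Q\<^esub> k2) (f x)"
      using h kB k fP by (simp add: BijGroup_def compose_def)
    then show ?case using generate.eng[OF k(1,3)] by blast
  qed
  then show "\<exists>\<psi>. \<psi> \<in> carrier (Inn Q t) \<and> (\<forall>x\<in>P. f (\<phi> x) = \<psi> (f x))"
    by (simp add: Q.carrier_Inn)
next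
  fix \<psi> \<psi>'
  assume *: "\<psi> \<in> carrier (Inn Q t) \<and> (\<forall>x\<in>P. f (\<phi> x) = \<psi> (f x))"
    "\<psi>' \<in> carrier (Inn Q t) \<and> (\<forall>x\<in>P. f (\<phi> x) = \<psi>' (f x))"
  then have "\<psi> \<in> extensional Q" "\<psi>' \<in> extensional Q"
    using quandle.Inn_subset_Bij[OF assms(2)] by (auto simp: Bij_def)
  moreover have "\<psi> y = \<psi>' y" if "y \<in> Q" for y
    using * that assms(4) by (metis imageE)
  ultimately show "\<psi> = \<psi>'" by (rule extensionalityI)
qed

end

theory Submission
  imports Defs
begin

text \<open>An inner automorphism \<open>g\<close> of \<open>P\<close> satisfies \<open>g s\<^sub>x g\<^sup>-\<^sup>1 = s\<^bsub>g x\<^esub>\<close>. If \<open>g\<close> lies in the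
  kernel of \<open>f\<^sub>*\<close>, then \<open>f (g x) = f x\<close>, so \<open>s\<^bsub>g x\<^esub>\<close> and \<open>s\<^sub>x\<close> agree modulo the relative
  transvections. Hence the class of \<open>g\<close> commutes with the classes of the generators \<open>s\<^sub>x\<close>.\<close>

section \<open>Quotients by subgroups of a kernel\<close>

text \<open>The elements of \<open>G\<close> whose image commutes with \<open>z\<close> form a
  subgroup, namely the preimage of the centralizer of \<open>z\<close>. This reduces centrality in a
  quotient to a check on generators.\<close>

lemma (in group_hom) commute_generate:
  assumes "S \<subseteq> carrier G" "z \<in> carrier H" "g \<in> generate G S"
    and comm: "\<And>x. x \<in> S \<Longrightarrow> z \<otimes>\<^bsub>H\<^esub> h x = h x \<otimes>\<^bsub>H\<^esub> z"
  shows "z \<otimes>\<^bsub>H\<^esub> h g = h g \<otimes>\<^bsub>H\<^esub> z"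
  using assms(3)
proof induction
  case one
  then show ?case using assms(2) by simp
next
  case (incl x)
  then show ?case by (rule comm)
next
  case (inv x)
  then have x: "x \<in> carrier G" using assms(1) by blast
  have "z \<otimes>\<^bsub>H\<^esub> h x = h x \<otimes>\<^bsub>H\<^esub> z" using comm inv by blast
  \<comment> \<open>Multiplying the commutation relation by the inverse of \<open>h x\<close> on
    both sides turns it into the relation for that inverse.\<close>
  then have "inv\<^bsub>H\<^esub> h x \<otimes>\<^bsub>H\<^esub> (z \<otimes>\<^bsub>H\<^esub> h x) \<otimes>\<^bsub>H\<^esub> inv\<^bsub>H\<^esub> h x =
      inv\<^bsub>H\<^esub> h x \<otimes>\<^bsub>H\<^esub> (h x \<otimes>\<^bsub>H\<^esub> z) \<otimes>\<^bsub>H\<^esub> inv\<^bsub>H\<^esub> h x" by simp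
  moreover have "inv\<^bsub>H\<^esub> h x \<otimes>\<^bsub>H\<^esub> (z \<otimes>\<^bsub>H\<^esub> h x) \<otimes>\<^bsub>H\<^esub> inv\<^bsub>H\<^esub> h x = inv\<^bsub>H\<^esub> h x \<otimes>\<^bsub>H\<^esub> z"
    using x assms(2) by (simp add: H.m_assoc)
  moreover have "inv\<^bsub>H\<^esub> h x \<otimes>\<^bsub>H\<^esub> (h x \<otimes>\<^bsub>H\<^esub> z) \<otimes>\<^bsub>H\<^esub> inv\<^bsub>H\<^esub> h x = z \<otimes>\<^bsub>H\<^esub> inv\<^bsub>H\<^esub> h x"
    using x assms(2) by (simp flip: H.m_assoc)
  ultimately show ?case using x by simp
next
  case (eng g1 g2)
  have g: "g1 \<in> carrier G" "g2 \<in> carrier G"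
    using eng.hyps G.generate_in_carrier[OF assms(1)] by blast+
  have "z \<otimes>\<^bsub>H\<^esub> (h g1 \<otimes>\<^bsub>H\<^esub> h g2) = (h g1 \<otimes>\<^bsub>H\<^esub> z) \<otimes>\<^bsub>H\<^esub> h g2"
    using g assms(2) by (simp flip: H.m_assoc eng.IH(1))
  also have "\<dots> = (h g1 \<otimes>\<^bsub>H\<^esub> h g2) \<otimes>\<^bsub>H\<^esub> z"
    using g assms(2) eng.IH by (simp add: H.m_assoc)
  finally show ?case using g by simp
qed

lemma (in group) conj_mult_inv:
  assumes "g \<in> carrier G" "a \<in> carrier G" "b \<in> carrier G"
  shows "g \<otimes> (a \<otimes> inv b) \<otimes> inv g = (g \<otimes> a \<otimes> inv g) \<otimes> inv (g \<otimes> b \<otimes> inv g)"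
proof -
  \<comment> \<open>After expanding the outer inverse and reassociating, this cancels the inner
    factors \<open>inv g\<close> and \<open>g\<close>.\<close>
  have "inv g \<otimes> (g \<otimes> c) = c" if "c \<in> carrier G" for c
    using that assms by (simp flip: m_assoc)
  then show ?thesis using assms by (simp add: inv_mult_group m_assoc)
qed

text \<open>Nonemptiness makes the image exactly the singleton of \<open>c\<close>, so that
  \<open>the_elem\<close> is determined.\<close>

lemma on_cosets_eq:
  assumes "X \<noteq> {}" "\<And>x. x \<in> X \<Longrightarrow> h x = c"
  shows "on_cosets h X = c"
  using assms by (simp add: on_cosets_def image_constant_conv cong: image_cong_simp)

lemma (in group_hom) on_cosets_r_coset:
  assumes "subgroup N G" "N \<subseteq> kernel G H h" "g \<in> carrier G"
  shows "on_cosets h (N #> g) = h g"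
proof (rule on_cosets_eq)
  show "N #> g \<noteq> {}" using assms G.rcos_self by blast
next
  fix x assume "x \<in> N #> g"
  then show "h x = h g" using assms(2,3) by (auto simp: r_coset_def kernel_def)
qed

text \<open>With \<open>K\<close> the kernel of \<open>h\<close>, this is the sequence from K/N
  through G/N to H. The second claim describes the image of K/N by representatives, the form in
  which centrality is tested.\<close>

lemma (in group_hom) short_exact_kernel_quotient:
  assumes N: "N \<lhd> G" and NK: "N \<subseteq> kernel G H h" and onto: "h ` carrier G = carrier H"
  shows "short_exact (G\<lparr>carrier := kernel G H h\<rparr> Mod N) (on_cosets (\<lambda>g. N #> g))
           (G Mod N) (on_cosets h) H"
    and "on_cosets (\<lambda>g. N #> g) ` carrier (G\<lparr>carrier := kernel G H h\<rparr> Mod N)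
           = (\<lambda>k. N #> k) ` kernel G H h"
proof -
  interpret N: normal N G by (rule N)
  let ?K = "kernel G H h" and ?i = "on_cosets (\<lambda>g. N #> g)"
  let ?A = "G\<lparr>carrier := ?K\<rparr> Mod N" and ?B = "G Mod N"
  have sub: "subgroup N G" by (rule N.subgroup_axioms)
  have carrier_A: "carrier ?A = (\<lambda>k. N #> k) ` ?K"
    by (simp add: carrier_FactGroup r_coset_def)
  \<comment> \<open>The quotient map is constant on a coset, its value being that coset; hence
    \<open>?i\<close> acts as the identity on cosets and is the inclusion of K/N in G/N.\<close>
  have i: "?i (N #> g) = N #> g" if "g \<in> carrier G" for g
  proof (rule on_cosets_eq)
    show "N #> g \<noteq> {}" using that sub G.rcos_self by blast
  next
    fix x assume "x \<in> N #> g"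
    then show "N #> x = N #> g" using that sub G.repr_independence by metis
  qed
  have i_A: "?i X = X" if "X \<in> carrier ?A" for X
  proof -
    obtain k where "k \<in> ?K" "X = N #> k" using \<open>X \<in> carrier ?A\<close> unfolding carrier_A by blast
    then show ?thesis using i by (simp add: kernel_def)
  qed
  have p: "on_cosets h (N #> g) = h g" if "g \<in> carrier G" for g
    using on_cosets_r_coset[OF sub NK that] .
  show image_i: "?i ` carrier ?A = (\<lambda>k. N #> k) ` ?K"
    using i_A carrier_A by simp
  have normal_NK: "N \<lhd> G\<lparr>carrier := ?K\<rparr>"
    using G.normal_restrict_supergroup[OF subgroup_kernel N NK] .
  have "group ?A" using normal.factorgroup_is_group[OF normal_NK] .
  moreover have "group ?B" by (rule N.factorgroup_is_group)
  moreover have "?i \<in> mon ?A ?B"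
  proof -
    have "carrier ?A \<subseteq> carrier ?B"
      unfolding carrier_A by (auto simp: carrier_FactGroup kernel_def)
    \<comment> \<open>Both products are set products of cosets, which depend on the multiplication
      of \<open>G\<close> and not on the carrier.\<close>
    moreover have "X \<otimes>\<^bsub>?A\<^esub> Y = X \<otimes>\<^bsub>?B\<^esub> Y" for X Y
      by (simp add: set_mult_def)
    moreover have "X \<otimes>\<^bsub>?A\<^esub> Y \<in> carrier ?A" if "X \<in> carrier ?A" "Y \<in> carrier ?A" for X Y
      using that \<open>group ?A\<close> by (simp add: group.is_monoid monoid.m_closed del: mult_FactGroup)
    ultimately show ?thesis
      using i_A by (auto simp: mon_def hom_def inj_on_def simp del: mult_FactGroup)
  qed
  moreover have "on_cosets h \<in> epi ?B H"
  proof -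
    have "on_cosets h \<in> hom ?B H"
    proof (rule homI)
      fix X assume "X \<in> carrier ?B"
      then show "on_cosets h X \<in> carrier H" using p by (auto simp: carrier_FactGroup)
    next
      fix X Y assume "X \<in> carrier ?B" "Y \<in> carrier ?B"
      then obtain x y where "x \<in> carrier G" "y \<in> carrier G" "X = N #> x" "Y = N #> y"
        by (auto simp: carrier_FactGroup)
      then show "on_cosets h (X \<otimes>\<^bsub>?B\<^esub> Y) = on_cosets h X \<otimes>\<^bsub>H\<^esub> on_cosets h Y"
        using p by (simp add: N.rcos_sum)
    qed
    moreover have "on_cosets h ` carrier ?B = h ` carrier G"
      using p by (auto simp: carrier_FactGroup image_image)
    ultimately show ?thesis using onto by (simp add: epi_def)
  qed
  \<comment> \<open>A coset of \<open>g\<close> is killed by the induced map iff \<open>h g\<close>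
    is the identity, that is, iff \<open>g\<close> lies in \<open>?K\<close>.\<close>
  moreover have "?i ` carrier ?A = kernel ?B H (on_cosets h)"
    unfolding image_i using p by (auto simp: kernel_def carrier_FactGroup)
  ultimately show "short_exact ?A ?i ?B (on_cosets h) H"
    by (simp add: short_exact_def)
qed

section \<open>Inner automorphisms of quandles\<close>

context quandle
begin

lemma gens_subset: "sym_perm Q s ` Q \<subseteq> carrier (BijGroup Q)"
  using sym_perm_Bij by (auto simp: carrier_BijGroup)

lemma sym_perm_Inn: "x \<in> Q \<Longrightarrow> sym_perm Q s x \<in> carrier (Inn Q s)"
  by (auto simp: carrier_Inn intro: generate.incl)

text \<open>Generation inside the subgroup agrees with generation in \<open>BijGroup Q\<close>. The
  form with \<open>Inn Q s\<close> as ambient group fits homomorphisms defined on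
  \<open>Inn Q s\<close>.\<close>

lemma generate_Inn: "generate (Inn Q s) (sym_perm Q s ` Q) = carrier (Inn Q s)"
proof -
  interpret B: group "BijGroup Q" by (rule group_BijGroup)
  have "subgroup (carrier (Inn Q s)) (BijGroup Q)"
    unfolding carrier_Inn by (rule B.generate_is_subgroup[OF gens_subset])
  moreover have "Inn Q s = BijGroup Q\<lparr>carrier := carrier (Inn Q s)\<rparr>"
    by (simp add: Inn_def subgroup_generated_def)
  ultimately show ?thesis
    using B.generate_consistent sym_perm_Inn carrier_Inn by (metis image_subsetI)
qed

lemma Inn_closed: "g \<in> carrier (Inn Q s) \<Longrightarrow> x \<in> Q \<Longrightarrow> g x \<in> Q"
  using Inn_subset_Bij Bij_imp_funcset by blast

lemma Inn_one: "\<one>\<^bsub>Inn Q s\<^esub> = (\<lambda>x\<in>Q. x)"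
  by (simp add: Inn_def BijGroup_def)

lemma Inn_mult:
  "g \<in> carrier (Inn Q s) \<Longrightarrow> h \<in> carrier (Inn Q s) \<Longrightarrow> g \<otimes>\<^bsub>Inn Q s\<^esub> h = compose Q g h"
  using Inn_subset_Bij by (auto simp: Inn_def BijGroup_def)

lemma closed: "x \<in> Q \<Longrightarrow> y \<in> Q \<Longrightarrow> s x y \<in> Q"
  using bij bij_betwE by blast

text \<open>Self-distributivity \<open>dist\<close> says that each generator respects the operation,
  and this property survives composition and inversion.\<close>

lemma Inn_automorphism:
  assumes "g \<in> carrier (Inn Q s)" "x \<in> Q" "y \<in> Q"
  shows "g (s x y) = s (g x) (g y)"
proof -
  have "g \<in> generate (BijGroup Q) (sym_perm Q s ` Q)" using assms(1) by (simp add: carrier_Inn)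
  then have "\<forall>x\<in>Q. \<forall>y\<in>Q. g (s x y) = s (g x) (g y)"
  proof induction
    case one
    then show ?case using closed by (simp add: BijGroup_def)
  next
    case (incl h)
    then obtain a where "a \<in> Q" "h = sym_perm Q s a" by blast
    then show ?case using closed dist[of a] by (simp add: sym_perm_def)
  next
    case (inv h)
    then have h: "h \<in> Bij Q" using sym_perm_Bij by blast
    obtain a where "a \<in> Q" "h = sym_perm Q s a" using inv by blast
    then have "h (s x y) = s (h x) (h y)" if "x \<in> Q" "y \<in> Q" for x y
      using that closed dist[of a x y] by (simp add: sym_perm_def)
    \<comment> \<open>The inverse of a bijection that respects a binary operation respects it
      too.\<close>
    then have "inv_into Q h (s x y) = s (inv_into Q h x) (inv_into Q h y)"
      if "x \<in> Q" "y \<in> Q" for x y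
      using that h closed by (intro Bij_inv_into_lemma) auto
    then show ?case using h closed by (simp add: inv_BijGroup)
  next
    case (eng h1 h2)
    then have "h1 \<in> Bij Q" "h2 \<in> Bij Q" using Inn_subset_Bij carrier_Inn by blast+
    moreover from this have "h2 x \<in> Q" if "x \<in> Q" for x using that Bij_imp_funcset by blast
    ultimately show ?case using eng.IH closed by (simp add: BijGroup_def compose_def)
  qed
  then show ?thesis using assms by blast
qed

text \<open>Evaluated at a point, this is \<open>Inn_automorphism\<close>;
  \<open>extensional\<close> representatives make pointwise agreement on \<open>Q\<close>
  sufficient.\<close>

lemma Inn_sym_perm_commute:
  assumes "g \<in> carrier (Inn Q s)" "x \<in> Q"
  shows "g \<otimes>\<^bsub>Inn Q s\<^esub> sym_perm Q s x = sym_perm Q s (g x) \<otimes>\<^bsub>Inn Q s\<^esub> g"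
proof -
  have "compose Q g (sym_perm Q s x) = compose Q (sym_perm Q s (g x)) g"
    using assms Inn_automorphism Inn_closed
    by (auto simp: compose_def sym_perm_def restrict_def)
  then show ?thesis
    using assms Inn_closed sym_perm_Inn by (simp add: Inn_mult)
qed

lemma Inn_conj_sym_perm:
  assumes "g \<in> carrier (Inn Q s)" "x \<in> Q"
  shows "g \<otimes>\<^bsub>Inn Q s\<^esub> sym_perm Q s x \<otimes>\<^bsub>Inn Q s\<^esub> inv\<^bsub>Inn Q s\<^esub> g = sym_perm Q s (g x)"
proof -
  interpret I: group "Inn Q s" by (rule group_Inn)
  show ?thesis
    using assms Inn_closed sym_perm_Inn by (simp add: Inn_sym_perm_commute I.m_assoc)
qed

end

section \<open>Surjective quandle homomorphisms\<close>

locale quandle_epi = P: quandle P s + Q: quandle Q t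
  for P :: "'a set" and s and Q :: "'b set" and t +
  fixes f :: "'a \<Rightarrow> 'b"
  assumes hom: "quandle_hom P s Q t f" and onto: "f ` P = Q"
begin

sublocale InnP: group "Inn P s" by (rule group_Inn)
sublocale InnQ: group "Inn Q t" by (rule group_Inn)

lemma f_closed: "x \<in> P \<Longrightarrow> f x \<in> Q"
  using onto by blast

lemma f_s: "x \<in> P \<Longrightarrow> y \<in> P \<Longrightarrow> f (s x y) = t (f x) (f y)"
  using hom by (simp add: quandle_hom_def)

section \<open>The induced homomorphism of inner automorphism groups\<close>

lemma Inn_map_ex1': "g \<in> carrier (Inn P s) \<Longrightarrow>
    \<exists>!\<psi>. \<psi> \<in> carrier (Inn Q t) \<and> (\<forall>x\<in>P. f (g x) = \<psi> (f x))"
  by (rule Inn_map_ex1[OF P.quandle_axioms Q.quandle_axioms hom onto])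

lemma
  assumes "g \<in> carrier (Inn P s)"
  shows Inn_map_closed: "Inn_map P Q t f g \<in> carrier (Inn Q t)"
    and Inn_map_apply: "x \<in> P \<Longrightarrow> Inn_map P Q t f g (f x) = f (g x)"
  using theI'[OF Inn_map_ex1'[OF assms], folded Inn_map_def] by simp_all

lemma Inn_map_eqI:
  assumes "g \<in> carrier (Inn P s)" "\<psi> \<in> carrier (Inn Q t)" "\<And>x. x \<in> P \<Longrightarrow> f (g x) = \<psi> (f x)"
  shows "Inn_map P Q t f g = \<psi>"
  unfolding Inn_map_def using assms by (intro the1_equality Inn_map_ex1') auto

lemma Inn_map_sym_perm: "x \<in> P \<Longrightarrow> Inn_map P Q t f (sym_perm P s x) = sym_perm Q t (f x)"
  using f_closed f_s
  by (intro Inn_map_eqI P.sym_perm_Inn Q.sym_perm_Inn) (auto simp: sym_perm_def)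

sublocale Inn_map: group_hom "Inn P s" "Inn Q t" "Inn_map P Q t f"
proof unfold_locales
  show "Inn_map P Q t f \<in> hom (Inn P s) (Inn Q t)"
  proof (rule homI)
    fix g h assume gh: "g \<in> carrier (Inn P s)" "h \<in> carrier (Inn P s)"
    \<comment> \<open>Stacking the defining squares of \<open>g\<close> and \<open>h\<close> shows
      that the product of their images satisfies the defining equation for the image of the
      product.\<close>
    then have "f ((g \<otimes>\<^bsub>Inn P s\<^esub> h) x) =
        (Inn_map P Q t f g \<otimes>\<^bsub>Inn Q t\<^esub> Inn_map P Q t f h) (f x)" if "x \<in> P" for x
      using that f_closed P.Inn_closed Inn_map_closed Inn_map_apply
      by (simp add: P.Inn_mult Q.Inn_mult compose_def)
    then show "Inn_map P Q t f (g \<otimes>\<^bsub>Inn P s\<^esub> h) =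
        Inn_map P Q t f g \<otimes>\<^bsub>Inn Q t\<^esub> Inn_map P Q t f h"
      using gh Inn_map_closed by (intro Inn_map_eqI) auto
  qed (rule Inn_map_closed)
qed

text \<open>Since \<open>f\<close> is onto, the images of the generators of \<open>Inn P s\<close>
  are all the generators of \<open>Inn Q t\<close>.\<close>

lemma Inn_map_onto: "Inn_map P Q t f ` carrier (Inn P s) = carrier (Inn Q t)"
proof -
  have "Inn_map P Q t f ` sym_perm P s ` P = sym_perm Q t ` Q"
    using Inn_map_sym_perm by (auto simp: image_image simp flip: onto)
  moreover have "sym_perm P s ` P \<subseteq> carrier (Inn P s)" using P.sym_perm_Inn by blast
  ultimately show ?thesis
    using Inn_map.generate_img[of "sym_perm P s ` P"] P.generate_Inn Q.generate_Inn by simp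
qed

section \<open>Relative transvections and centrality\<close>

lemma Inn_rel_fixes_fibres: "k \<in> Inn_rel P s Q t f \<Longrightarrow> x \<in> P \<Longrightarrow> f (k x) = f x"
  using Inn_map_apply[of k x] f_closed by (auto simp: Inn_rel_def kernel_def Q.Inn_one)

lemma transvection_in_Trans_rel:
  assumes "x \<in> P" "y \<in> P" "f x = f y"
  shows "sym_perm P s x \<otimes>\<^bsub>Inn P s\<^esub> inv\<^bsub>Inn P s\<^esub> sym_perm P s y \<in> Trans_rel P s f"
  unfolding Trans_rel_def using assms by (intro generate.incl) blast

text \<open>Conjugation by \<open>g\<close> sends the generator for the pair \<open>x\<close>,
  \<open>y\<close> to the one for \<open>g x\<close>, \<open>g y\<close>, so the generating set is
  stable under conjugation.\<close>

lemma Trans_rel_normal: "Trans_rel P s f \<lhd> Inn P s"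
  unfolding Trans_rel_def
proof (rule InnP.normal_generateI, goal_cases)
  case 1
  then show ?case using P.sym_perm_Inn by auto
next
  case (2 h g)
  then obtain x y where xy: "x \<in> P" "y \<in> P" "f x = f y"
    and h: "h = sym_perm P s x \<otimes>\<^bsub>Inn P s\<^esub> inv\<^bsub>Inn P s\<^esub> sym_perm P s y" by blast
  have "g \<otimes>\<^bsub>Inn P s\<^esub> h \<otimes>\<^bsub>Inn P s\<^esub> inv\<^bsub>Inn P s\<^esub> g =
      (g \<otimes>\<^bsub>Inn P s\<^esub> sym_perm P s x \<otimes>\<^bsub>Inn P s\<^esub> inv\<^bsub>Inn P s\<^esub> g) \<otimes>\<^bsub>Inn P s\<^esub>
      inv\<^bsub>Inn P s\<^esub> (g \<otimes>\<^bsub>Inn P s\<^esub> sym_perm P s y \<otimes>\<^bsub>Inn P s\<^esub> inv\<^bsub>Inn P s\<^esub> g)"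
    unfolding h using xy 2 P.sym_perm_Inn by (intro InnP.conj_mult_inv) auto
  also have "\<dots> = sym_perm P s (g x) \<otimes>\<^bsub>Inn P s\<^esub> inv\<^bsub>Inn P s\<^esub> sym_perm P s (g y)"
    using xy 2 by (simp add: P.Inn_conj_sym_perm)
  \<comment> \<open>Both sides are the value of the induced map of \<open>g\<close> at the common
    point \<open>f x = f y\<close>.\<close>
  moreover have "f (g x) = f (g y)"
    using xy 2 Inn_map_apply by metis
  ultimately show ?case using xy 2 P.Inn_closed by auto
qed

text \<open>Each generator goes to a product of a permutation \<open>sym_perm Q t (f x)\<close> with
  its own inverse, and the kernel is a subgroup.\<close>

lemma Trans_rel_subset_Inn_rel: "Trans_rel P s f \<subseteq> Inn_rel P s Q t f"
  unfolding Trans_rel_def Inn_rel_def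
proof (intro InnP.generate_subgroup_incl Inn_map.subgroup_kernel, safe)
  fix x y assume "x \<in> P" "y \<in> P" "f x = f y"
  then show "sym_perm P s x \<otimes>\<^bsub>Inn P s\<^esub> inv\<^bsub>Inn P s\<^esub> sym_perm P s y
      \<in> kernel (Inn P s) (Inn Q t) (Inn_map P Q t f)"
    using P.sym_perm_Inn Q.sym_perm_Inn f_closed by (simp add: kernel_def Inn_map_sym_perm)
qed

lemma Inn_rel_central:
  assumes "k \<in> Inn_rel P s Q t f"
  shows "Trans_rel P s f #>\<^bsub>Inn P s\<^esub> k \<in> group_center (Inn P s Mod Trans_rel P s f)"
proof -
  interpret N: normal "Trans_rel P s f" "Inn P s" by (rule Trans_rel_normal)
  let ?M = "Inn P s Mod Trans_rel P s f"
  let ?q = "\<lambda>g. Trans_rel P s f #>\<^bsub>Inn P s\<^esub> g"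
  interpret M: group ?M by (rule N.factorgroup_is_group)
  interpret q: group_hom "Inn P s" ?M ?q
    by unfold_locales (rule N.r_coset_hom_Mod)
  have k: "k \<in> carrier (Inn P s)" using assms by (simp add: Inn_rel_def kernel_def)
  have comm: "?q k \<otimes>\<^bsub>?M\<^esub> ?q (sym_perm P s x) = ?q (sym_perm P s x) \<otimes>\<^bsub>?M\<^esub> ?q k" if x: "x \<in> P" for x
  proof -
    have kx: "k x \<in> P" using k x by (rule P.Inn_closed)
    \<comment> \<open>As \<open>k\<close> keeps \<open>x\<close> in its fibre, \<open>k x\<close>
      and \<open>x\<close> form an admissible pair for a relative transvection; this puts their
      symmetries in the same coset.\<close>
    have "sym_perm P s (k x) \<otimes>\<^bsub>Inn P s\<^esub> inv\<^bsub>Inn P s\<^esub> sym_perm P s x \<in> Trans_rel P s f"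
      using kx x Inn_rel_fixes_fibres[OF assms x] by (rule transvection_in_Trans_rel)
    then have "sym_perm P s (k x) \<in> ?q (sym_perm P s x)"
      using N.rcos_module_rev kx x P.sym_perm_Inn InnP.is_group by metis
    then have same: "?q (sym_perm P s (k x)) = ?q (sym_perm P s x)"
      using InnP.repr_independence N.subgroup_axioms P.sym_perm_Inn x by metis
    \<comment> \<open>Without \<open>mult_FactGroup\<close> the product stays a product in
      \<open>?M\<close>, so that the homomorphism property of \<open>?q\<close> applies.\<close>
    have "?q k \<otimes>\<^bsub>?M\<^esub> ?q (sym_perm P s x) = ?q (k \<otimes>\<^bsub>Inn P s\<^esub> sym_perm P s x)"
      using k x P.sym_perm_Inn by (simp del: mult_FactGroup)
    also have "\<dots> = ?q (sym_perm P s (k x)) \<otimes>\<^bsub>?M\<^esub> ?q k"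
      using k x kx P.sym_perm_Inn by (simp add: P.Inn_sym_perm_commute del: mult_FactGroup)
    finally show ?thesis by (simp only: same)
  qed
  have "?q k \<otimes>\<^bsub>?M\<^esub> ?q g = ?q g \<otimes>\<^bsub>?M\<^esub> ?q k" if "g \<in> carrier (Inn P s)" for g
  proof (rule q.commute_generate[of "sym_perm P s ` P"])
    show "?q k \<otimes>\<^bsub>?M\<^esub> ?q a = ?q a \<otimes>\<^bsub>?M\<^esub> ?q k" if "a \<in> sym_perm P s ` P" for a
      using that comm by blast
  qed (use that k P.generate_Inn P.sym_perm_Inn in auto)
  moreover have "?q k \<in> carrier ?M" using k by (rule q.hom_closed)
  ultimately show ?thesis
    by (auto simp: group_center_def carrier_FactGroup)
qed

end

theorem proposition0p5:
  fixes P :: "'a set" and s :: "'a \<Rightarrow> 'a \<Rightarrow> 'a"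
    and Q :: "'b set" and t :: "'b \<Rightarrow> 'b \<Rightarrow> 'b"
    and f :: "'a \<Rightarrow> 'b"
  assumes "quandle P s" and "quandle Q t"
    and "quandle_hom P s Q t f" and "f ` P = Q"
  shows "central_extension
           (H_quot P s Q t f)
           (on_cosets (\<lambda>\<phi>. Trans_rel P s f #>\<^bsub>Inn P s\<^esub> \<phi>))
           (Inn P s Mod Trans_rel P s f)
           (on_cosets (Inn_map P Q t f))
           (Inn Q t)"
proof -
  interpret quandle_epi P s Q t f
    using assms by (simp add: quandle_epi_def quandle_epi_axioms_def)
  \<comment> \<open>The first fact is exactness; the second writes the image of
    \<open>H_quot\<close> as the cosets of elements of \<open>Inn_rel\<close>, to which
    \<open>Inn_rel_central\<close> applies.\<close>
  note exact = Inn_map.short_exact_kernel_quotient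
    [OF Trans_rel_normal Trans_rel_subset_Inn_rel[unfolded Inn_rel_def] Inn_map_onto]
  show ?thesis
    unfolding central_extension_def H_quot_def Inn_rel_def
    using exact Inn_rel_central by (auto simp: Inn_rel_def)
qed

end
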